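(* Let $S$ be any signed graph (whose underlying graph is finite, simple, undirected and connected). Then: (i) $imb_S(v_iv_j)\ge imb_S^+(v_iv_j)-imb_S^-(v_iv_j)$ for every edge $v_iv_j\in E(S)$; (ii) $irr(S)\ge irr^+(S)-irr^-(S)$; (iii) $irr_t(S)\ge irr_t^+(S)-irr_t^-(S)$.
   Context: All graphs are finite, simple, undirected and connected. A signed graph $S=S(G,\sigma)$ is a graph $G$ with vertex set $V(G)$ and edge set $E(G)$ together with a function $\sigma:E(G)\to\{+,-\}$; $V(S)=V(G)$, $E(S)=E(G)$. For a vertex $v$, $d_S^+(v)$ is the number of positive edges incident with $v$, $d_S^-(v)$ is the number of negative edges incident with $v$, and $\hat d_S(v)=d_S^+(v)-d_S^-(v)$ is the net-degree of $v$. For an edge $uv$: $imb_S(uv)=|\hat d_S(u)-\hat d_S(v)|$, $imb_S^+(uv)=|d_S^+(u)-d_S^+(v)|$, $imb_S^-(uv)=|d_S^-(u)-d_S^-(v)|$. Irregularities: $irr(S)=\sum_{uv\in E(S)}imb_S(uv)$, $irr^+(S)=\sum_{uv\in E(S)}imb_S^+(uv)$, $irr^-(S)=\sum_{uv\in E(S)}imb_S^-(uv)$. Total irregularities: $irr_t(S)=\frac12\sum_{u,v\in V(S)}|\hat d_S(u)-\hat d_S(v)|$, $irr_t^+(S)=\frac12\sum_{u,v\in V(S)}|d_S^+(u)-d_S^+(v)|$, $irr_t^-(S)=\frac12\sum_{u,v\in V(S)}|d_S^-(u)-d_S^-(v)|$, the sums being over all ordered pairs $(u,v)$ of vertices. 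*)

theory Defs
  imports Complex_Main "Graph_Theory.Digraph_Component" "Graph_Theory.Pair_Digraph"
begin

text \<open>
  As in the Graph-Theory library, an undirected graph is a symmetric digraph; the predicate
  \<open>pair_graph\<close> says that it is finite, symmetric and loop-free, and arcs being pairs of vertices,
  there are no multiple edges. Each undirected edge corresponds to two opposite arcs, so signs,
  degrees and edge sums refer to the two-element vertex sets collected in \<open>edges\<close>.
\<close>

datatype sign = Positive | Negative

record 'a signed_graph =
  underlying :: "'a pair_pre_digraph"
  edge_sign :: "'a set \<Rightarrow> sign"  \<comment> \<open>only the values on \<open>edges\<close> matter\<close>

definition vertices :: "'a signed_graph \<Rightarrow> 'a set" where
  "vertices S = pverts (underlying S)"

definition edges :: "'a signed_graph \<Rightarrow> 'a set set" where
  "edges S = {{u, v} | u v. (u, v) \<in> parcs (underlying S)}"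

definition pos_degree :: "'a signed_graph \<Rightarrow> 'a \<Rightarrow> nat" where
  "pos_degree S v = card {e \<in> edges S. v \<in> e \<and> edge_sign S e = Positive}"

definition neg_degree :: "'a signed_graph \<Rightarrow> 'a \<Rightarrow> nat" where
  "neg_degree S v = card {e \<in> edges S. v \<in> e \<and> edge_sign S e = Negative}"

definition net_degree :: "'a signed_graph \<Rightarrow> 'a \<Rightarrow> int" where
  "net_degree S v = int (pos_degree S v) - int (neg_degree S v)"

text \<open>
  The absolute difference of a vertex function across an edge, well defined because it
  does not depend on the order of the endpoints (see \<open>edge_diff_pair\<close>).
\<close>

definition edge_diff :: "('a \<Rightarrow> int) \<Rightarrow> 'a set \<Rightarrow> int" where
  "edge_diff f e = (THE k. \<exists>u v. e = {u, v} \<and> k = \<bar>f u - f v\<bar>)"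

lemma edge_diff_pair [simp]: "edge_diff f {u, v} = \<bar>f u - f v\<bar>"
  unfolding edge_diff_def by (rule the_equality) (auto simp: doubleton_eq_iff)

definition imb :: "'a signed_graph \<Rightarrow> 'a set \<Rightarrow> int" where
  "imb S e = edge_diff (net_degree S) e"

definition imb_pos :: "'a signed_graph \<Rightarrow> 'a set \<Rightarrow> int" where
  "imb_pos S e = edge_diff (\<lambda>v. int (pos_degree S v)) e"

definition imb_neg :: "'a signed_graph \<Rightarrow> 'a set \<Rightarrow> int" where
  "imb_neg S e = edge_diff (\<lambda>v. int (neg_degree S v)) e"

definition irr :: "'a signed_graph \<Rightarrow> int" where
  "irr S = (\<Sum>e\<in>edges S. imb S e)"

definition irr_pos :: "'a signed_graph \<Rightarrow> int" where
  "irr_pos S = (\<Sum>e\<in>edges S. imb_pos S e)"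

definition irr_neg :: "'a signed_graph \<Rightarrow> int" where
  "irr_neg S = (\<Sum>e\<in>edges S. imb_neg S e)"

definition irr_t :: "'a signed_graph \<Rightarrow> real" where
  "irr_t S = 1 / 2 * (\<Sum>(u, v)\<in>vertices S \<times> vertices S.
     \<bar>real_of_int (net_degree S u) - real_of_int (net_degree S v)\<bar>)"

definition irr_t_pos :: "'a signed_graph \<Rightarrow> real" where
  "irr_t_pos S = 1 / 2 * (\<Sum>(u, v)\<in>vertices S \<times> vertices S.
     \<bar>real (pos_degree S u) - real (pos_degree S v)\<bar>)"

definition irr_t_neg :: "'a signed_graph \<Rightarrow> real" where
  "irr_t_neg S = 1 / 2 * (\<Sum>(u, v)\<in>vertices S \<times> vertices S.
     \<bar>real (neg_degree S u) - real (neg_degree S v)\<bar>)"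

end

theory Submission
  imports Defs
begin

text \<open>
  Everything is the reverse triangle inequality, applied to one pair of vertices at a time.
  Since the net-degree is the positive degree minus the negative degree, the difference of the
  positive degrees of two vertices is the difference of their net-degrees plus that of their
  negative degrees; taking absolute values, the net imbalance and the negative imbalance together
  dominate the positive one. Summing this bound over the edges gives the irregularities, and summing
  it over the ordered pairs of vertices gives the total irregularities.
\<close>

lemma net_degree_diff_ge:
  "\<bar>net_degree S u - net_degree S v\<bar>
    \<ge> \<bar>int (pos_degree S u) - int (pos_degree S v)\<bar> - \<bar>int (neg_degree S u) - int (neg_degree S v)\<bar>"
  unfolding net_degree_def by linarith

lemma imb_ge: "imb S {u, v} \<ge> imb_pos S {u, v} - imb_neg S {u, v}"
  using net_degree_diff_ge by (simp add: imb_def imb_pos_def imb_neg_def)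

lemma irr_ge: "irr S \<ge> irr_pos S - irr_neg S"
proof -
  have "imb_pos S e - imb_neg S e \<le> imb S e" if e: "e \<in> edges S" for e
  proof -
    obtain u v where "e = {u, v}"
      using e unfolding edges_def by blast
    then show ?thesis
      using imb_ge by metis
  qed
  then show ?thesis
    unfolding irr_def irr_pos_def irr_neg_def sum_subtractf [symmetric] by (rule sum_mono)
qed

lemma irr_t_ge: "irr_t S \<ge> irr_t_pos S - irr_t_neg S"
proof -
  have "(case p of (u, v) \<Rightarrow> \<bar>real (pos_degree S u) - real (pos_degree S v)\<bar>)
      - (case p of (u, v) \<Rightarrow> \<bar>real (neg_degree S u) - real (neg_degree S v)\<bar>)
    \<le> (case p of (u, v) \<Rightarrow> \<bar>real_of_int (net_degree S u) - real_of_int (net_degree S v)\<bar>)" for p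
    by (cases p) (simp add: net_degree_def)
  then show ?thesis
    unfolding irr_t_def irr_t_pos_def irr_t_neg_def
      right_diff_distrib [symmetric] sum_subtractf [symmetric]
    by (intro mult_left_mono sum_mono) auto
qed

theorem theorem4:
  fixes S :: "'a signed_graph"
  assumes "pair_graph (underlying S)"
    and "Digraph_Component.connected (with_proj (underlying S))"
  shows "(\<forall>u v. {u, v} \<in> edges S \<longrightarrow> imb S {u, v} \<ge> imb_pos S {u, v} - imb_neg S {u, v})
    \<and> irr S \<ge> irr_pos S - irr_neg S
    \<and> irr_t S \<ge> irr_t_pos S - irr_t_neg S"
  by (intro conjI allI impI imb_ge irr_ge irr_t_ge)

end
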